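(* Let $K\subset\mathbb{R}^2$ be an $o$-symmetric convex body such that the closed unit disc $B^2$ centred at $o$ is either the John ellipse of $K$ or the Löwner ellipse of $K$. Then $$V(K)+V(K^* )\le 2\pi.$$
   Context: $o$ denotes the origin of $\mathbb{R}^2$; a set $K$ is $o$-symmetric if $K=-K$. A convex body is a compact convex set with nonempty interior. $V(\cdot)$ denotes area. $K^*=\{x\in\mathbb{R}^2:\langle x,y\rangle\le 1\text{ for all }y\in K\}$ is the polar body. The John ellipse of an $o$-symmetric planar convex body $K$ is the (unique) $o$-symmetric ellipse (as a filled region) of maximal area contained in $K$; the Löwner ellipse of $K$ is the (unique) $o$-symmetric ellipse of minimal area containing $K$. *)

theory Defs
  imports "HOL-Analysis.Analysis"
begin

definition convex_body :: "'a::euclidean_space set \<Rightarrow> bool" where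
  "convex_body K \<longleftrightarrow> compact K \<and> convex K \<and> interior K \<noteq> {}"

definition origin_symmetric :: "'a::real_vector set \<Rightarrow> bool" where
  "origin_symmetric K \<longleftrightarrow> K = uminus ` K"

definition polar_body :: "'a::real_inner set \<Rightarrow> 'a set" where
  "polar_body K = {x. \<forall>y\<in>K. x \<bullet> y \<le> 1}"

text \<open>Ellipses are filled and nondegenerate: the images of the closed unit disc under
  invertible affine maps.\<close>

definition ellipse :: "(real ^ 2) set \<Rightarrow> bool" where
  "ellipse E \<longleftrightarrow> (\<exists>(f :: real ^ 2 \<Rightarrow> real ^ 2) c. linear f \<and> bij f \<and> E = (\<lambda>x. c + f x) ` cball 0 1)"

text \<open>The John and Loewner ellipses are described as relations. The extremal ellipse is
  unique whenever \<open>K\<close> is an origin-symmetric convex body, so no separate uniqueness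
  clause is imposed.\<close>

definition is_John_ellipse :: "(real ^ 2) set \<Rightarrow> (real ^ 2) set \<Rightarrow> bool" where
  "is_John_ellipse E K \<longleftrightarrow>
     ellipse E \<and> origin_symmetric E \<and> E \<subseteq> K \<and>
     (\<forall>E'. ellipse E' \<and> origin_symmetric E' \<and> E' \<subseteq> K \<longrightarrow> measure lebesgue E' \<le> measure lebesgue E)"

definition is_Loewner_ellipse :: "(real ^ 2) set \<Rightarrow> (real ^ 2) set \<Rightarrow> bool" where
  "is_Loewner_ellipse E K \<longleftrightarrow>
     ellipse E \<and> origin_symmetric E \<and> K \<subseteq> E \<and>
     (\<forall>E'. ellipse E' \<and> origin_symmetric E' \<and> K \<subseteq> E' \<longrightarrow> measure lebesgue E \<le> measure lebesgue E')"

end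

theory Submission
  imports Defs "HOL-Real_Asymp.Real_Asymp"
begin

text \<open>By polarity assume that the unit disc lies inside \<open>K\<close>, with polar \<open>L\<close>, and let \<open>h\<close> be the support
  function of \<open>K\<close>. Formally \<open>2 * (V K + V L)\<close> is the integral of \<open>h\<^sup>2 - h'\<^sup>2 + h\<^sup>-\<^sup>2\<close> over a full turn.
  With \<open>\<psi> = (h - 1/h) / 2\<close> the integrand equals \<open>2 + 4 \<psi>\<^sup>2 - h'\<^sup>2\<close>, and \<open>\<bar>\<psi>'\<bar> \<le> \<bar>h'\<bar>\<close> because \<open>h \<ge> 1\<close>.
  Extremality of the disc forces a contact direction, \<open>h = 1\<close>, in every closed arc of length \<open>\<pi>/2\<close>;
  between neighbouring contact directions \<open>\<psi>\<close> vanishes at both ends, and Wirtinger's inequality on an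
  interval of length at most \<open>\<pi>/2\<close> bounds the integral of \<open>4 \<psi>\<^sup>2\<close> by that of \<open>\<psi>'\<^sup>2\<close>. The
  differentiability of \<open>h\<close> is avoided by sampling \<open>h\<close> at equidistant angles, covering \<open>K\<close> and \<open>L\<close>
  by triangles, and using a discrete Wirtinger inequality.\<close>

section \<open>A discrete Wirtinger inequality\<close>

text \<open>Discrete Picone argument: \<open>w j\<close>, the sine of \<open>2 j d\<close>, solves
  the extremal recurrence with eigenvalue \<open>s\<close>, and \<open>n d \<le> pi / 2\<close>
  keeps it positive for \<open>0 < j < n\<close>. Comparing \<open>f\<close> with \<open>w\<close>
  step by step leaves only squares and a nonnegative end term.\<close>

lemma discrete_Wirtinger:
  fixes f :: "nat \<Rightarrow> real"
  assumes d: "0 < d" "real n * d \<le> pi / 2" and f0: "f 0 = 0" "f n = 0"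
  shows "4 * (sin d)\<^sup>2 * (\<Sum>j<n. (f j)\<^sup>2) \<le> (\<Sum>j<n. (f (Suc j) - f j)\<^sup>2)"
proof -
  define w where "w j = sin (2 * real j * d)" for j
  define s where "s = 4 * (sin d)\<^sup>2"
  have w_pos: "0 < w j" if "0 < j" "j < n" for j
  proof -
    have "real j * d < real n * d" using that d by simp
    then have "2 * real j * d < pi" using d by linarith
    then show ?thesis unfolding w_def using that d by (intro sin_gt_zero) auto
  qed
  have w_n: "0 \<le> w n" unfolding w_def using d by (intro sin_ge_zero) auto
  have w_rec: "w j + w (Suc (Suc j)) = (2 - s) * w (Suc j)" for j
  proof -
    define x where "x = 2 * real (Suc j) * d"
    have "2 * real j * d = x - 2 * d" "2 * real (Suc (Suc j)) * d = x + 2 * d"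
      by (simp_all add: x_def algebra_simps)
    then have "w j + w (Suc (Suc j)) = 2 * cos (2 * d) * w (Suc j)"
      unfolding w_def x_def[symmetric] by (simp add: sin_add sin_diff)
    also have "2 * cos (2 * d) = 2 - s"
      unfolding s_def by (simp add: cos_double_sin)
    finally show ?thesis .
  qed
  have w_ratio: "s - 1 + w j / w (Suc j) = 1 - w (Suc (Suc j)) / w (Suc j)" if "Suc j < n" for j
    using w_pos[of "Suc j"] that w_rec[of j] by (simp add: field_simps)
  \<comment> \<open>The second summand is the Riccati boundary term; for \<open>k = 0\<close> it is
    the square of \<open>f 1\<close>, because \<open>w 0 = 0\<close>.\<close>
  have partial: "s * (\<Sum>j<Suc k. (f j)\<^sup>2) + (f (Suc k))\<^sup>2 * (1 - w k / w (Suc k))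
      \<le> (\<Sum>j<Suc k. (f (Suc j) - f j)\<^sup>2)" if "Suc k < n" for k
    using that
  proof (induction k)
    case 0
    then show ?case using f0 by (simp add: w_def)
  next
    case (Suc k)
    define r where "r = w (Suc (Suc k)) / w (Suc k)"
    have r: "r > 0" using w_pos Suc.prems by (simp add: r_def)
    \<comment> \<open>Picone square: it vanishes exactly when this step of \<open>f\<close> has the
      ratio of \<open>w\<close>.\<close>
    have "(f (Suc (Suc k)) - f (Suc k))\<^sup>2 - (f (Suc k))\<^sup>2 * (1 - r)
        - (f (Suc (Suc k)))\<^sup>2 * (1 - 1 / r) = (r * f (Suc k) - f (Suc (Suc k)))\<^sup>2 / r"
      using r by (simp add: field_simps power2_eq_square)
    also have "\<dots> \<ge> 0" using r by simp
    finally have nonneg: "0 \<le> (f (Suc (Suc k)) - f (Suc k))\<^sup>2 - (f (Suc k))\<^sup>2 * (1 - r)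
        - (f (Suc (Suc k)))\<^sup>2 * (1 - 1 / r)" .
    have "(f (Suc k))\<^sup>2 * (s - 1 + w k / w (Suc k)) + (f (Suc (Suc k)))\<^sup>2 * (1 - w (Suc k) / w (Suc (Suc k)))
      \<le> (f (Suc (Suc k)) - f (Suc k))\<^sup>2"
    proof -
      have *: "s - 1 + w k / w (Suc k) = 1 - r" "w (Suc k) / w (Suc (Suc k)) = 1 / r"
        using w_ratio[of k] Suc.prems by (auto simp: r_def)
      show ?thesis unfolding * using nonneg by linarith
    qed
    then show ?case using Suc by (simp add: algebra_simps)
  qed
  consider "n = 0" | "n = 1" | k where "n = Suc (Suc k)"
    by (metis One_nat_def not0_implies_Suc)
  then show ?thesis
  proof cases
    case 3
    \<comment> \<open>As \<open>f n = 0\<close>, the last difference contributes just the square of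
      \<open>f (Suc k)\<close>. A coefficient of at most 1 is therefore required, and
      \<open>w n \<ge> 0\<close> supplies it.\<close>
    have "w n / w (Suc k) \<ge> 0" using w_n w_pos[of "Suc k"] 3 by simp
    then have "(f (Suc k))\<^sup>2 * (s - 1 + w k / w (Suc k)) \<le> (f (Suc k))\<^sup>2 * 1"
      using w_ratio[of k] 3 by (intro mult_left_mono) auto
    then show ?thesis using partial[of k] 3 f0 by (simp add: s_def algebra_simps)
  qed (use f0 in auto)
qed

lemma sum_shift_squares:
  fixes h :: "nat \<Rightarrow> real"
  assumes "h 0 = h n"
  shows "(\<Sum>j<n. (h (Suc j))\<^sup>2) = (\<Sum>j<n. (h j)\<^sup>2)"
proof -
  have "(\<Sum>j<n. (h (Suc j))\<^sup>2 - (h j)\<^sup>2) = 0"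
    using sum_lessThan_telescope[of "\<lambda>j. (h j)\<^sup>2" n] assms by simp
  then show ?thesis by (simp add: sum_subtractf)
qed

text \<open>The summands are, up to a factor 2, the areas of a kite circumscribed to \<open>K\<close> and of a triangle
  containing a piece of \<open>L\<close>; the right-hand side is \<open>2 * n * d\<close> up to a factor \<open>1 + O(d)\<close>.\<close>

lemma support_sequence_bound:
  fixes h :: "nat \<Rightarrow> real"
  assumes d: "0 < d" "real n * d \<le> pi / 2" "M * d \<le> 1 / 2"
    and h0: "h 0 = 1" "h n = 1"
    and h: "\<And>j. j \<le> n \<Longrightarrow> 1 \<le> h j" "\<And>j. j \<le> n \<Longrightarrow> h j \<le> M"
  shows "(\<Sum>j<n. (2 * h j * h (Suc j) - cos d * ((h j)\<^sup>2 + (h (Suc j))\<^sup>2)) / sin d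
            + sin d / (h j - M * d)\<^sup>2)
    \<le> real n * ((2 * (1 - cos d) / sin d - sin d * cos d) * M\<^sup>2 + sin d * (1 - cos d)
        + 2 * sin d * cos d + 8 * M * d * sin d)"
proof (cases "n = 0")
  case False
  define c s where "c = cos d" and "s = sin d"
  have "1 * d \<le> real n * d" using False d by (intro mult_right_mono) auto
  then have dpi: "d \<le> pi / 2" using d by linarith
  have s: "s > 0" unfolding s_def using d dpi by (intro sin_gt_zero) auto
  have c: "0 \<le> c" "c \<le> 1" unfolding c_def using d dpi by (auto intro!: cos_ge_zero)
  have sc: "s\<^sup>2 + c\<^sup>2 = 1" by (simp add: s_def c_def)
  have M: "M \<ge> 1" using h[of 0] by simp
  \<comment> \<open>Samples of \<open>\<psi>\<close>. They vanish at both ends because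
    \<open>h\<close> is 1 there.\<close>
  define q where "q j = (h j - 1 / h j) / 2" for j
  \<comment> \<open>The factor \<open>(1 + 1 / (x y)) / 2\<close> is the difference quotient of
    \<open>(x - 1 / x) / 2\<close>; it is at most 1 on \<open>x, y \<ge> 1\<close>.\<close>
  have step: "(q (Suc j) - q j)\<^sup>2 \<le> (h (Suc j) - h j)\<^sup>2" if "j < n" for j
  proof -
    have a: "1 \<le> h j" "1 \<le> h (Suc j)" using h that by auto
    have p: "1 \<le> h j * h (Suc j)" using mult_mono[OF a] a by simp
    have "q (Suc j) - q j = (h (Suc j) - h j) * ((1 + 1 / (h j * h (Suc j))) / 2)"
      using a by (simp add: q_def field_simps)
    moreover have "\<bar>(1 + 1 / (h j * h (Suc j))) / 2\<bar> \<le> 1" using p by (simp add: field_simps)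
    ultimately have "\<bar>q (Suc j) - q j\<bar> \<le> \<bar>h (Suc j) - h j\<bar>"
      by (metis abs_mult abs_ge_zero mult.right_neutral mult_left_mono)
    then show ?thesis by (simp add: abs_le_square_iff)
  qed
  have "4 * s\<^sup>2 * (\<Sum>j<n. (q j)\<^sup>2) \<le> (\<Sum>j<n. (q (Suc j) - q j)\<^sup>2)"
    unfolding s_def using d h0 by (intro discrete_Wirtinger) (auto simp: q_def)
  also have "\<dots> \<le> (\<Sum>j<n. (h (Suc j) - h j)\<^sup>2)" by (intro sum_mono step) auto
  finally have W: "4 * s\<^sup>2 * (\<Sum>j<n. (q j)\<^sup>2) \<le> (\<Sum>j<n. (h (Suc j) - h j)\<^sup>2)" .
  \<comment> \<open>Scaling by \<open>c / s\<close> matches the coefficient of the squared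
    differences in \<open>summand\<close>.\<close>
  have W': "s * c * (\<Sum>j<n. 4 * (q j)\<^sup>2) \<le> c / s * (\<Sum>j<n. (h (Suc j) - h j)\<^sup>2)"
    using mult_left_mono[OF W, of "c / s"] s c
    unfolding sum_distrib_left[symmetric] by (simp add: power2_eq_square mult_ac)
  have summand: "(2 * h j * h (Suc j) - c * ((h j)\<^sup>2 + (h (Suc j))\<^sup>2)) / s + s / (h j - M * d)\<^sup>2
      \<le> (1 - c) / s * ((h j)\<^sup>2 + (h (Suc j))\<^sup>2) + s / (h j)\<^sup>2 + 8 * M * d * s
        - c / s * (h (Suc j) - h j)\<^sup>2" if "j < n" for j
  proof -
    define e where "e = M * d"
    have e: "0 \<le> e" "e \<le> 1 / 2" using M d by (auto simp: e_def)
    define a b where "a = h j" and "b = h (Suc j)"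
    have a: "1 \<le> a" using h that by (auto simp: a_def)
    have ae: "a - e \<ge> 1 / 2" using a e by simp
    have "2 * a * b - c * (a\<^sup>2 + b\<^sup>2) = (1 - c) * (2 * a * b) - c * (b - a)\<^sup>2"
      by (simp add: power2_eq_square algebra_simps)
    also have "\<dots> \<le> (1 - c) * (a\<^sup>2 + b\<^sup>2) - c * (b - a)\<^sup>2"
      using c sum_squares_bound[of a b] by (intro diff_right_mono mult_left_mono) auto
    finally have "(2 * a * b - c * (a\<^sup>2 + b\<^sup>2)) / s
        \<le> ((1 - c) * (a\<^sup>2 + b\<^sup>2) - c * (b - a)\<^sup>2) / s"
      using s by (intro divide_right_mono) auto
    then have 1: "(2 * a * b - c * (a\<^sup>2 + b\<^sup>2)) / s
        \<le> (1 - c) / s * (a\<^sup>2 + b\<^sup>2) - c / s * (b - a)\<^sup>2"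
      by (simp only: diff_divide_distrib[of "(1 - c) * (a\<^sup>2 + b\<^sup>2)"] times_divide_eq_left)
    \<comment> \<open>Since \<open>a - e \<ge> 1 / 2\<close> and \<open>a \<ge> 1\<close>, passing
      from \<open>a\<close> to \<open>a - e\<close> raises the reciprocal square by at most
      \<open>8 e\<close>. This is the source of the error term \<open>8 M d sin d\<close>.\<close>
    have "1 \<le> 4 * (a - e)\<^sup>2"
      using power_mono[OF ae, of 2] by (simp add: power2_eq_square)
    then have "2 * e * a \<le> 2 * e * a * (4 * (a - e)\<^sup>2)"
      using mult_left_mono[of 1 "4 * (a - e)\<^sup>2" "2 * e * a"] e a by simp
    also have "\<dots> \<le> 8 * e * (a\<^sup>2 * (a - e)\<^sup>2)"
      using mult_left_mono[of a "a\<^sup>2" "8 * e * (a - e)\<^sup>2"] e a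
      by (simp add: self_le_power mult_ac)
    finally have "2 * e * a - e\<^sup>2 \<le> 8 * e * (a\<^sup>2 * (a - e)\<^sup>2)"
      using zero_le_power2[of e] by linarith
    then have "a\<^sup>2 - (a - e)\<^sup>2 \<le> 8 * e * (a\<^sup>2 * (a - e)\<^sup>2)"
      by (simp add: power2_diff mult_ac)
    then have "1 / (a - e)\<^sup>2 \<le> 1 / a\<^sup>2 + 8 * e"
      using a ae by (simp add: field_simps)
    from mult_left_mono[OF this, of s] s
    have 2: "s / (a - e)\<^sup>2 \<le> s / a\<^sup>2 + 8 * e * s" by (simp add: algebra_simps)
    show ?thesis using 1 2 by (simp add: a_def b_def e_def)
  qed
  have q4: "4 * (q j)\<^sup>2 = (h j)\<^sup>2 - 2 + 1 / (h j)\<^sup>2" if "j < n" for j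
  proof -
    have "h j \<noteq> 0" using h(1)[of j] that by simp
    then show ?thesis by (simp add: q_def field_simps power2_eq_square)
  qed
  \<comment> \<open>This sign permits replacing \<open>h j\<close> by \<open>M\<close> at the end.
    The quantity is the difference of \<open>2 tan (d / 2)\<close> and \<open>sin (2 d) / 2\<close>,
    hence of order \<open>d^3\<close>.\<close>
  have coef: "0 \<le> 2 * (1 - c) / s - s * c"
  proof -
    have "s * c * s = c * (1 - c) * (1 + c)" using sc by algebra
    also have "\<dots> \<le> (1 - c) * 2"
      using c mult_mono[of c 1 "1 + c" 2] mult_left_mono[of "c * (1 + c)" 2 "1 - c"]
      by (simp add: algebra_simps)
    finally show ?thesis using s by (simp add: field_simps)
  qed
  have "(\<Sum>j<n. (2 * h j * h (Suc j) - c * ((h j)\<^sup>2 + (h (Suc j))\<^sup>2)) / s + s / (h j - M * d)\<^sup>2)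
    \<le> (\<Sum>j<n. (1 - c) / s * ((h j)\<^sup>2 + (h (Suc j))\<^sup>2) + s / (h j)\<^sup>2 + 8 * M * d * s
        - c / s * (h (Suc j) - h j)\<^sup>2)"
    by (intro sum_mono summand) auto
  also have "\<dots> = (1 - c) / s * ((\<Sum>j<n. (h j)\<^sup>2) + (\<Sum>j<n. (h (Suc j))\<^sup>2))
      + (\<Sum>j<n. s / (h j)\<^sup>2 + 8 * M * d * s) - c / s * (\<Sum>j<n. (h (Suc j) - h j)\<^sup>2)"
    by (simp add: sum.distrib sum_subtractf sum_distrib_left algebra_simps)
  also have "\<dots> \<le> 2 * (1 - c) / s * (\<Sum>j<n. (h j)\<^sup>2)
      + (\<Sum>j<n. s / (h j)\<^sup>2 + 8 * M * d * s) - s * c * (\<Sum>j<n. 4 * (q j)\<^sup>2)"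
  proof -
    have "(\<Sum>j<n. (h (Suc j))\<^sup>2) = (\<Sum>j<n. (h j)\<^sup>2)"
      using h0 by (intro sum_shift_squares) simp
    moreover have "(1 - c) / s * (H + H) = 2 * (1 - c) / s * H" for H
      by (simp add: field_simps)
    ultimately have "(1 - c) / s * ((\<Sum>j<n. (h j)\<^sup>2) + (\<Sum>j<n. (h (Suc j))\<^sup>2))
        = 2 * (1 - c) / s * (\<Sum>j<n. (h j)\<^sup>2)"
      by simp
    then show ?thesis using W' by linarith
  qed
  also have "\<dots> = (\<Sum>j<n. 2 * (1 - c) / s * (h j)\<^sup>2 + s / (h j)\<^sup>2 + 8 * M * d * s
      - s * c * (4 * (q j)\<^sup>2))"
    by (simp only: sum.distrib sum_subtractf sum_distrib_left)
  also have "\<dots> \<le> (\<Sum>j<n. (2 * (1 - c) / s - s * c) * M\<^sup>2 + s * (1 - c) + 2 * s * c + 8 * M * d * s)"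
  proof (intro sum_mono)
    fix j assume "j \<in> {..<n}"
    then have j: "j < n" by simp
    have 1: "1 \<le> h j" "h j \<le> M" using h j by auto
    have "(2 * (1 - c) / s - s * c) * (h j)\<^sup>2 \<le> (2 * (1 - c) / s - s * c) * M\<^sup>2"
      using coef 1 by (intro mult_left_mono power_mono) auto
    moreover have "1 / (h j)\<^sup>2 \<le> 1" using 1 by (simp add: one_le_power)
    then have "s * (1 - c) * (1 / (h j)\<^sup>2) \<le> s * (1 - c)"
      using s c by (intro mult_left_le) auto
    ultimately show "2 * (1 - c) / s * (h j)\<^sup>2 + s / (h j)\<^sup>2 + 8 * M * d * s - s * c * (4 * (q j)\<^sup>2)
      \<le> (2 * (1 - c) / s - s * c) * M\<^sup>2 + s * (1 - c) + 2 * s * c + 8 * M * d * s"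
      unfolding q4[OF j] by (simp add: algebra_simps diff_divide_distrib)
  qed
  also have "\<dots> = real n * ((2 * (1 - c) / s - s * c) * M\<^sup>2 + s * (1 - c) + 2 * s * c + 8 * M * d * s)"
    by simp
  finally show ?thesis unfolding c_def s_def .
qed simp

section \<open>Plane geometry\<close>

definition dir :: "real \<Rightarrow> real ^ 2" where
  "dir t = vector [cos t, sin t]"

text \<open>The planar cross product: the determinant with columns \<open>x\<close> and
  \<open>y\<close>, positive when \<open>y\<close> lies less than a half turn counterclockwise from
  \<open>x\<close>.\<close>

definition crs :: "real ^ 2 \<Rightarrow> real ^ 2 \<Rightarrow> real" where
  "crs x y = x $ 1 * y $ 2 - x $ 2 * y $ 1"

lemma inner_2: "x \<bullet> y = x $ 1 * y $ 1 + x $ 2 * y $ 2" for x y :: "real ^ 2"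
  by (simp add: inner_vec_def sum_2)

lemma vec2_eq_iff: "x = y \<longleftrightarrow> x $ 1 = y $ 1 \<and> x $ 2 = y $ 2" for x y :: "'a ^ 2"
  by (simp add: vec_eq_iff forall_2)

lemma dir_nth [simp]: "dir t $ 1 = cos t" "dir t $ 2 = sin t"
  by (simp_all add: dir_def)

lemma inner_dir_dir: "dir s \<bullet> dir t = cos (s - t)"
  by (simp add: inner_2 cos_diff)

lemma crs_dir_dir: "crs (dir s) (dir t) = sin (t - s)"
  by (simp add: crs_def sin_diff)

lemma norm_dir [simp]: "norm (dir t) = 1"
  by (simp add: norm_eq_sqrt_inner inner_dir_dir)

lemma crs_scaleR [simp]: "crs (c *\<^sub>R x) y = c * crs x y" "crs x (c *\<^sub>R y) = c * crs x y"
  by (simp_all add: crs_def algebra_simps)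

lemma polar_form_0:
  fixes x :: "real ^ 2"
  obtains r t where "0 \<le> r" "0 \<le> t" "t \<le> 2 * pi" "x = r *\<^sub>R dir t"
proof (cases "x = 0")
  case True
  then show ?thesis using that[of 0 0] by simp
next
  case False
  have "(x $ 1 / norm x)\<^sup>2 + (x $ 2 / norm x)\<^sup>2 = 1"
    using False unfolding power_divide add_divide_distrib[symmetric]
    by (simp add: power2_norm_eq_inner inner_2 vec2_eq_iff flip: power2_eq_square)
  then obtain t where t: "0 \<le> t" "t \<le> 2 * pi" "x $ 1 / norm x = cos t" "x $ 2 / norm x = sin t"
    using sincos_total_2pi_le by blast
  show ?thesis
    by (rule that[of "norm x" t]) (use t(1,2) False in \<open>auto simp: vec2_eq_iff simp flip: t(3,4)\<close>)
qed

lemma orthonormal_expansion: "(dir m \<bullet> x) *\<^sub>R dir m + crs (dir m) x *\<^sub>R dir (m + pi / 2) = x"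
proof -
  have "(sin m)\<^sup>2 + (cos m)\<^sup>2 = 1" by simp
  then have "(dir m \<bullet> x) * cos m - crs (dir m) x * sin m = x $ 1"
    "(dir m \<bullet> x) * sin m + crs (dir m) x * cos m = x $ 2"
    unfolding inner_2 crs_def dir_nth by algebra+
  then show ?thesis by (simp add: vec2_eq_iff sin_add cos_add)
qed

lemma polar_form:
  fixes x :: "real ^ 2"
  obtains r t where "0 \<le> r" "m \<le> t" "t \<le> m + 2 * pi" "x = r *\<^sub>R dir t"
proof -
  obtain r t where rt: "0 \<le> r" "0 \<le> t" "t \<le> 2 * pi"
    "vector [dir m \<bullet> x, crs (dir m) x] = r *\<^sub>R dir t"
    using polar_form_0 by blast
  have "dir m \<bullet> x = r * cos t" "crs (dir m) x = r * sin t"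
    using rt(4) by (simp_all add: vec2_eq_iff)
  then have "x = r *\<^sub>R (cos t *\<^sub>R dir m + sin t *\<^sub>R dir (m + pi / 2))"
    using orthonormal_expansion[of m x] by (simp add: scaleR_add_right)
  also have "cos t *\<^sub>R dir m + sin t *\<^sub>R dir (m + pi / 2) = dir (m + t)"
    by (simp add: vec2_eq_iff sin_add cos_add)
  finally show ?thesis using that[of r "m + t"] rt by simp
qed

lemma dir_add_pi: "dir (t + pi) = - dir t"
  by (simp add: vec2_eq_iff)

text \<open>Allowing negative \<open>r\<close> keeps the angle within a quarter turn of
  \<open>m\<close>, the range of \<open>t\<close> in \<open>unstretchable\<close>.\<close>

lemma line_form:
  fixes x :: "real ^ 2"
  obtains r t where "\<bar>t - m\<bar> \<le> pi / 2" "x = r *\<^sub>R dir t"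
proof -
  obtain r t where rt: "m - pi / 2 \<le> t" "t \<le> m - pi / 2 + 2 * pi" "x = r *\<^sub>R dir t"
    using polar_form by metis
  show ?thesis
  proof (cases "t \<le> m + pi / 2")
    case True
    then have "\<bar>t - m\<bar> \<le> pi / 2" using rt(1) by linarith
    then show ?thesis using rt(3) that by blast
  next
    case False
    then have "\<bar>(t - pi) - m\<bar> \<le> pi / 2" using rt(2) by linarith
    then show ?thesis using rt(3) dir_add_pi[of "t - pi"] that[of "t - pi" "- r"] by simp
  qed
qed

lemma dist_dir_le: "dist (dir s) (dir t) \<le> \<bar>s - t\<bar>"
proof -
  have "(dist (dir s) (dir t))\<^sup>2 = 2 - 2 * cos (s - t)"
    unfolding dist_norm power2_norm_eq_inner
    by (simp add: inner_diff_left inner_diff_right inner_dir_dir cos_diff)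
  also have "\<dots> = (2 * sin ((s - t) / 2))\<^sup>2"
  proof -
    define u where "u = (s - t) / 2"
    have "s - t = 2 * u" by (simp add: u_def)
    then show ?thesis by (simp add: cos_double_sin power_mult_distrib)
  qed
  also have "\<dots> \<le> (s - t)\<^sup>2"
    using abs_sin_x_le_abs_x[of "(s - t) / 2"] by (intro iffD1[OF abs_le_square_iff]) (simp add: abs_mult)
  finally show ?thesis by (simp add: abs_le_square_iff[symmetric])
qed

section \<open>Triangles with a vertex at the origin, and sectors\<close>

lemma triangle_lmeasurable: "convex hull {0, p, q} \<in> lmeasurable" for p q :: "real ^ 2"
  by (intro lmeasurable_compact finite_imp_compact_convex_hull) auto

lemma measure_triangle: "measure lebesgue (convex hull {0, p, q}) = \<bar>crs p q\<bar> / 2"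
proof -
  have "convex hull {0, p, q} \<in> sets borel"
    by (intro borel_compact finite_imp_compact_convex_hull) auto
  then have "measure lebesgue (convex hull {0, p, q}) = measure lborel (convex hull {0, p, q})"
    by simp
  also have "\<dots> = \<bar>crs p q\<bar> / 2"
    unfolding content_triangle by (simp add: crs_def abs_minus_commute algebra_simps)
  finally show ?thesis .
qed

lemma measure_le_triangles:
  fixes X :: "(real ^ 2) set" and n :: nat
  assumes "X \<in> lmeasurable" "\<And>x. x \<in> X \<Longrightarrow> \<exists>j<n. x \<in> convex hull {0, p j, q j}"
  shows "measure lebesgue X \<le> (\<Sum>j<n. \<bar>crs (p j) (q j)\<bar>) / 2"
proof -
  let ?U = "\<Union>j<n. convex hull {0, p j, q j}"
  have "measure lebesgue X \<le> measure lebesgue ?U"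
    using assms by (intro measure_mono_fmeasurable fmeasurable.finite_UN)
      (auto simp: triangle_lmeasurable fmeasurableD)
  also have "\<dots> \<le> (\<Sum>j<n. measure lebesgue (convex hull {0, p j, q j}))"
    by (intro measure_UNION_le) (auto simp: triangle_lmeasurable fmeasurableD)
  finally show ?thesis by (simp add: measure_triangle sum_divide_distrib)
qed

lemma in_triangleI:
  assumes "0 \<le> a" "0 \<le> b" "a + b \<le> 1" "x = a *\<^sub>R p + b *\<^sub>R q"
  shows "x \<in> convex hull {0, p, q}"
proof -
  have "\<exists>u v w. x = u *\<^sub>R 0 + v *\<^sub>R p + w *\<^sub>R q \<and> 0 \<le> u \<and> 0 \<le> v \<and> 0 \<le> w \<and> u + v + w = 1"
    by (rule exI[of _ "1 - a - b"], rule exI[of _ a], rule exI[of _ b]) (use assms in simp)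
  then show ?thesis unfolding convex_hull_3 by blast
qed

text \<open>Cramer's rule: the sign conditions say that both coefficients are nonnegative.\<close>

lemma cone_coordinates:
  assumes "0 < crs p q" "0 \<le> crs p x" "crs q x \<le> 0"
  obtains a b where "0 \<le> a" "0 \<le> b" "x = a *\<^sub>R p + b *\<^sub>R q"
proof
  show "0 \<le> - crs q x / crs p q" "0 \<le> crs p x / crs p q"
    using assms by (simp_all add: divide_nonpos_pos)
  show "x = (- crs q x / crs p q) *\<^sub>R p + (crs p x / crs p q) *\<^sub>R q"
    using assms(1) by (simp add: vec2_eq_iff field_simps) (simp add: crs_def algebra_simps)
qed

lemma parallel_scaling:
  assumes "crs p x = 0"
  shows "(w \<bullet> p) *\<^sub>R x = (w \<bullet> x) *\<^sub>R p"
proof -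
  have "p $ 1 * x $ 2 = p $ 2 * x $ 1" using assms by (simp add: crs_def)
  then have "(w \<bullet> p) * x $ 1 = (w \<bullet> x) * p $ 1" "(w \<bullet> p) * x $ 2 = (w \<bullet> x) * p $ 2"
    unfolding inner_2 by algebra+
  then show ?thesis by (simp add: vec2_eq_iff)
qed

text \<open>The side \<open>p q\<close> lies on the line \<open>w \<bullet> x = h\<close>, so
  \<open>x = a p + b q\<close> gives \<open>(a + b) h = w \<bullet> x \<le> h\<close>. If
  \<open>crs p q = 0\<close>, then \<open>p = q\<close> and the triangle is a segment; this happens
  when two vertices of a circumscribed polygon coincide.\<close>

lemma triangle_coverage:
  assumes w: "w \<bullet> p = h" "w \<bullet> q = h" "0 < h" and x: "0 \<le> w \<bullet> x" "w \<bullet> x \<le> h"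
    and crs: "0 \<le> crs p q" "0 \<le> crs p x" "crs q x \<le> 0"
  shows "x \<in> convex hull {0, p, q}"
proof (cases "crs p q = 0")
  case False
  then have "0 < crs p q" using crs(1) by simp
  then obtain a b where ab: "0 \<le> a" "0 \<le> b" "x = a *\<^sub>R p + b *\<^sub>R q"
    using cone_coordinates[OF _ crs(2,3)] by blast
  have "(a + b) * h \<le> 1 * h" using x(2) ab w by (simp add: inner_add_right algebra_simps)
  then have "a + b \<le> 1" using w by (simp only: mult_le_cancel_right_pos)
  then show ?thesis using ab by (intro in_triangleI)
next
  case True
  have "x = (w \<bullet> x / h) *\<^sub>R p"
  proof -
    have "q = p" using parallel_scaling[of p q w] True w by simp
    then have "crs p x = 0" using crs by simp
    then have "(1 / h) *\<^sub>R h *\<^sub>R x = (1 / h) *\<^sub>R (w \<bullet> x) *\<^sub>R p"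
      using parallel_scaling[of p x w] w by simp
    then show ?thesis using w by simp
  qed
  then show ?thesis using x w by (intro in_triangleI[of "w \<bullet> x / h" 0]) auto
qed

text \<open>A discrete intermediate value argument: the sign of \<open>crs (q j) x\<close> has to
  change somewhere.\<close>

lemma fan_step:
  fixes q :: "nat \<Rightarrow> real ^ 2"
  assumes "0 \<le> crs (q 0) x" "crs (q n) x \<le> 0" "0 < n"
  shows "\<exists>j<n. 0 \<le> crs (q j) x \<and> crs (q (Suc j)) x \<le> 0"
  using assms
proof (induction n)
  case (Suc n)
  then show ?case by (cases "n = 0"; cases "0 \<le> crs (q n) x") (auto intro: less_SucI)
qed simp

text \<open>Two half-planes; they meet in the cone between the two directions for
  \<open>0 < b - a < pi\<close>, and in a full line for \<open>a = b\<close>.\<close>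

definition sector :: "real \<Rightarrow> real \<Rightarrow> (real ^ 2) set" where
  "sector a b = {x. 0 \<le> crs (dir a) x \<and> crs (dir b) x \<le> 0}"

lemma closed_sector: "closed (sector a b)"
  unfolding sector_def crs_def by (intro closed_Collect_conj closed_Collect_le continuous_intros)

text \<open>Both generators of the cone are within a quarter turn of \<open>dir t\<close>, so both
  cosines are nonnegative.\<close>

lemma sector_inner_nonneg:
  assumes "a < b" "b \<le> a + pi / 2" "a \<le> t" "t \<le> b" "x \<in> sector a b"
  shows "0 \<le> dir t \<bullet> x"
proof -
  have "0 < crs (dir a) (dir b)"
    unfolding crs_dir_dir using assms by (intro sin_gt_zero) (auto simp: algebra_simps intro: le_less_trans)
  then obtain u v where uv: "0 \<le> u" "0 \<le> v" "x = u *\<^sub>R dir a + v *\<^sub>R dir b"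
    using assms cone_coordinates[of "dir a" "dir b" x] by (auto simp: sector_def)
  have "0 \<le> cos (t - a)" "0 \<le> cos (t - b)"
    using assms by (auto intro!: cos_ge_zero)
  then show ?thesis using uv by (simp add: inner_add_right inner_dir_dir)
qed

text \<open>The intersection of the lines \<open>dir A \<bullet> x = u\<close> and \<open>dir (A + d) \<bullet> x = v\<close>.\<close>

definition isect :: "real \<Rightarrow> real \<Rightarrow> real \<Rightarrow> real \<Rightarrow> real ^ 2" where
  "isect d A u v = (1 / sin d) *\<^sub>R vector [u * sin (A + d) - v * sin A, v * cos A - u * cos (A + d)]"

text \<open>Cramer's rule with determinant \<open>sin d\<close>. Neighbouring directions have inner
  product \<open>cos d\<close>, whence \<open>isect_dir\<close>. The last formula is twice the
  signed area of the triangle over the side on the line with value \<open>v\<close>.\<close>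

lemma
  assumes "sin d \<noteq> 0"
  shows inner_isect: "dir A \<bullet> isect d A u v = u" "dir (A + d) \<bullet> isect d A u v = v"
    and isect_dir: "isect d A (cos d) 1 = dir (A + d)" "isect d A 1 (cos d) = dir A"
    and crs_isect: "crs (isect d A u v) (isect d (A + d) v w) = v * (u + w - 2 * cos d * v) / sin d"
proof -
  have A: "(sin A)\<^sup>2 + (cos A)\<^sup>2 = 1" "(sin d)\<^sup>2 + (cos d)\<^sup>2 = 1" by simp_all
  have "cos A * (u * sin (A + d) - v * sin A) + sin A * (v * cos A - u * cos (A + d)) = u * sin d"
    using A unfolding sin_add cos_add by algebra
  then show "dir A \<bullet> isect d A u v = u"
    using assms by (simp add: isect_def inner_2 add_divide_distrib[symmetric])
  have "cos (A + d) * (u * sin (A + d) - v * sin A) + sin (A + d) * (v * cos A - u * cos (A + d))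
    = v * sin d"
    using A unfolding sin_add cos_add by algebra
  then show "dir (A + d) \<bullet> isect d A u v = v"
    using assms by (simp add: isect_def inner_2 add_divide_distrib[symmetric])
  have "cos d * sin (A + d) - sin A = cos (A + d) * sin d"
    "cos A - cos d * cos (A + d) = sin (A + d) * sin d"
    using A unfolding sin_add cos_add by algebra+
  then show "isect d A (cos d) 1 = dir (A + d)"
    using assms by (simp add: isect_def vec2_eq_iff)
  show "isect d A 1 (cos d) = dir A"
    using assms by (simp add: isect_def vec2_eq_iff sin_add cos_add)
  have "crs (vector [u * sin (A + d) - v * sin A, v * cos A - u * cos (A + d)])
      (vector [v * sin (A + d + d) - w * sin (A + d), w * cos (A + d) - v * cos (A + d + d)])
    = v * (u + w - 2 * cos d * v) * sin d"
    using A unfolding crs_def vector_2 sin_add cos_add by algebra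
  then show "crs (isect d A u v) (isect d (A + d) v w) = v * (u + w - 2 * cos d * v) / sin d"
    using assms by (simp add: isect_def)
qed

section \<open>Areas in a sector between two contact directions\<close>

text \<open>The lines \<open>dir (a + j d) \<bullet> x = h j\<close> bound a circumscribed polygon,
  cut into triangles from the origin. By \<open>conv\<close> its sides are properly oriented;
  summation by parts turns the \<open>n + 1\<close> triangle areas into \<open>n\<close> kite
  areas.\<close>

lemma sector_measure_circumscribed:
  fixes h :: "nat \<Rightarrow> real"
  assumes n: "0 < n" and d: "0 < d" "real n * d \<le> pi / 2"
    and X: "X \<in> lmeasurable" "X \<subseteq> sector a (a + real n * d)"
    and le: "\<And>x j. x \<in> X \<Longrightarrow> j \<le> n \<Longrightarrow> dir (a + real j * d) \<bullet> x \<le> h j"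
    and h: "h 0 = 1" "h n = 1" "\<And>j. j \<le> n \<Longrightarrow> 1 \<le> h j"
    and conv: "\<And>j. Suc (Suc j) \<le> n \<Longrightarrow> 2 * cos d * h (Suc j) \<le> h j + h (Suc (Suc j))"
  shows "measure lebesgue X
    \<le> (\<Sum>j<n. (2 * h j * h (Suc j) - cos d * ((h j)\<^sup>2 + (h (Suc j))\<^sup>2)) / sin d) / 2"
proof -
  have "1 * d \<le> real n * d" using n d by (intro mult_right_mono) auto
  then have dpi: "d \<le> pi / 2" using d by linarith
  have s: "sin d > 0" using d dpi by (intro sin_gt_zero) auto
  have c: "0 \<le> cos d" "cos d \<le> 1" using d dpi by (auto intro!: cos_ge_zero)
  \<comment> \<open>With the fictitious values \<open>cos d\<close> at both ends, the contact points \<open>dir a\<close> and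
    \<open>dir (a + n * d)\<close> become intersection points of consecutive lines as well.\<close>
  define g where "g i = (if i = 0 \<or> i = Suc (Suc n) then cos d else h (i - 1))" for i
  define m where "m i = a + (real i - 1) * d" for i
  define q where "q i = isect d (m i) (g i) (g (Suc i))" for i
  have m_Suc: "m (Suc i) = m i + d" for i by (simp add: m_def algebra_simps)
  have g_Suc: "g (Suc i) = h i" if "i \<le> n" for i using that by (simp add: g_def)
  \<comment> \<open>Nonnegative signed side lengths. At the two ends the value \<open>cos d\<close>
    only requires the neighbouring \<open>h\<close> to be at least \<open>cos d\<close>.\<close>
  have g_conv: "2 * cos d * g (Suc i) \<le> g i + g (Suc (Suc i))" if "i \<le> n" for i
  proof -
    show ?thesis
    proof (cases i)
      case 0
      have "cos d \<le> h 1" using h(3)[of 1] n c by linarith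
      then show ?thesis using 0 h(1) n by (simp add: g_def)
    next
      case (Suc j)
      have "cos d \<le> h j" using h(3)[of j] Suc that c by linarith
      then show ?thesis using that Suc h(2) conv[of j] by (cases "i = n") (auto simp: g_def)
    qed
  qed
  have crs_q: "crs (q i) (q (Suc i)) = g (Suc i) * (g i + g (Suc (Suc i)) - 2 * cos d * g (Suc i)) / sin d" for i
    unfolding q_def m_Suc using s by (simp add: crs_isect)
  have crs_q_nonneg: "0 \<le> crs (q i) (q (Suc i))" if "i \<le> n" for i
    unfolding crs_q using g_conv[OF that] h(3)[OF that] s that by (auto simp: g_Suc)
  have q_ends: "q 0 = dir a" "q (Suc n) = dir (a + real n * d)"
    using isect_dir[of d] s n h by (simp_all add: q_def m_def g_def algebra_simps)
  have cover: "\<exists>i<Suc n. x \<in> convex hull {0, q i, q (Suc i)}" if x: "x \<in> X" for x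
  proof -
    have "0 \<le> crs (q 0) x" "crs (q (Suc n)) x \<le> 0"
      using X x unfolding q_ends sector_def by auto
    then obtain i where i: "i < Suc n" "0 \<le> crs (q i) x" "crs (q (Suc i)) x \<le> 0"
      using fan_step[of q x "Suc n"] by auto
    let ?w = "dir (a + real i * d)"
    have mi: "m (Suc i) = a + real i * d" by (simp add: m_def)
    have "?w \<bullet> q i = h i" "?w \<bullet> q (Suc i) = h i"
      using inner_isect(2)[of d "m i" "g i" "g (Suc i)"] inner_isect(1)[of d "m (Suc i)"] s i
      unfolding q_def m_Suc[symmetric] mi by (simp_all add: g_Suc)
    moreover have "0 < h i" using h(3)[of i] i by simp
    moreover have "0 \<le> ?w \<bullet> x"
      using x X n d i by (intro sector_inner_nonneg[of a "a + real n * d"]) (auto intro!: mult_right_mono)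
    moreover have "?w \<bullet> x \<le> h i" using le x i by simp
    ultimately have "x \<in> convex hull {0, q i, q (Suc i)}"
      using i crs_q_nonneg[of i] by (intro triangle_coverage[of ?w _ "h i"]) auto
    then show ?thesis using i by blast
  qed
  let ?G = "\<lambda>j. 2 * h j * h (Suc j) - cos d * ((h j)\<^sup>2 + (h (Suc j))\<^sup>2)"
  \<comment> \<open>Regrouping from sides to pairs of consecutive sides. The remainder cancels
    against the last triangle when \<open>Suc k = n\<close>, because \<open>h n = 1\<close>.\<close>
  have partial: "(\<Sum>i<Suc k. h i * (g i + g (Suc (Suc i)) - 2 * cos d * h i))
      = (\<Sum>j<Suc k. ?G j) + cos d * (h (Suc k))\<^sup>2 - h (Suc k) * h k" if "Suc k \<le> n" for k
    using that
  proof (induction k)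
    case 0
    then show ?case using h by (simp add: g_def algebra_simps power2_eq_square)
  next
    case (Suc k)
    then show ?case by (simp add: g_def algebra_simps power2_eq_square)
  qed
  obtain k where k: "n = Suc k" using n gr0_conv_Suc by blast
  have "(\<Sum>i<Suc n. \<bar>crs (q i) (q (Suc i))\<bar>) = (\<Sum>i<Suc n. h i * (g i + g (Suc (Suc i)) - 2 * cos d * h i) / sin d)"
    using crs_q_nonneg by (intro sum.cong) (simp_all add: crs_q g_Suc del: abs_divide)
  also have "\<dots> = (\<Sum>i<Suc n. h i * (g i + g (Suc (Suc i)) - 2 * cos d * h i)) / sin d"
    by (simp only: sum_divide_distrib)
  also have "\<dots> = (\<Sum>j<n. ?G j) / sin d"
    using partial[of k] h k by (simp add: g_def)
  finally show ?thesis
    using measure_le_triangles[OF X(1) cover] by (simp add: sum_divide_distrib)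
qed

text \<open>Between consecutive directions, the half-plane \<open>x \<bullet> y j \<le> 1\<close>
  cuts off a triangle. Both its corners have distance at most \<open>1 / r j\<close> from the
  origin, so its area is at most \<open>sin d / (2 (r j)^2)\<close>.\<close>

lemma sector_measure_inscribed:
  fixes r :: "nat \<Rightarrow> real"
  assumes n: "0 < n" and d: "0 < d" "real n * d \<le> pi / 2"
    and X: "X \<in> lmeasurable" "X \<subseteq> sector a (a + real n * d)"
    and r: "\<And>j. j < n \<Longrightarrow> 0 < r j"
    and y: "\<And>x j. x \<in> X \<Longrightarrow> j < n \<Longrightarrow> x \<bullet> y j \<le> 1"
      "\<And>j. j < n \<Longrightarrow> r j \<le> dir (a + real j * d) \<bullet> y j"
      "\<And>j. j < n \<Longrightarrow> r j \<le> dir (a + real (Suc j) * d) \<bullet> y j"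
  shows "measure lebesgue X \<le> (\<Sum>j<n. sin d / (r j)\<^sup>2) / 2"
proof -
  have "1 * d \<le> real n * d" using n d by (intro mult_right_mono) auto
  then have dpi: "d \<le> pi / 2" using d by linarith
  have s: "sin d > 0" using d dpi by (intro sin_gt_zero) auto
  define p where "p j = dir (a + real j * d)" for j
  have crs_p: "crs (p j) (p (Suc j)) = sin d" for j
    by (simp add: p_def crs_dir_dir algebra_simps)
  have cover: "\<exists>j<n. x \<in> convex hull {0, (1 / r j) *\<^sub>R p j, (1 / r j) *\<^sub>R p (Suc j)}" if x: "x \<in> X" for x
  proof -
    have "0 \<le> crs (p 0) x" "crs (p n) x \<le> 0"
      using X x unfolding p_def sector_def by auto
    then obtain j where j: "j < n" "0 \<le> crs (p j) x" "crs (p (Suc j)) x \<le> 0"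
      using fan_step n by blast
    then obtain u v where uv: "0 \<le> u" "0 \<le> v" "x = u *\<^sub>R p j + v *\<^sub>R p (Suc j)"
      using cone_coordinates[of "p j" "p (Suc j)" x] crs_p s by auto
    have "(u + v) * r j \<le> u * (p j \<bullet> y j) + v * (p (Suc j) \<bullet> y j)"
      using uv y(2,3)[OF j(1)] unfolding p_def distrib_right by (intro add_mono mult_left_mono)
    also have "\<dots> = x \<bullet> y j" using uv by (simp add: inner_add_left)
    also have "\<dots> \<le> 1" using y(1) x j by blast
    finally have "u * r j + v * r j \<le> 1" by (simp add: algebra_simps)
    then have "x \<in> convex hull {0, (1 / r j) *\<^sub>R p j, (1 / r j) *\<^sub>R p (Suc j)}"
      using uv r[OF j(1)] by (intro in_triangleI[of "u * r j" "v * r j"]) auto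
    then show ?thesis using j by blast
  qed
  show ?thesis
    using measure_le_triangles[OF X(1) cover] s by (simp add: crs_p power2_eq_square)
qed

section \<open>The support function of a compact set, by angle\<close>

definition supp :: "(real ^ 2) set \<Rightarrow> real \<Rightarrow> real" where
  "supp K t = (SUP y\<in>K. dir t \<bullet> y)"

lemma supp_bdd: "compact K \<Longrightarrow> bdd_above ((\<lambda>y. dir t \<bullet> y) ` K)"
  by (intro bounded_imp_bdd_above compact_imp_bounded compact_continuous_image continuous_intros)

lemma inner_le_supp: "compact K \<Longrightarrow> y \<in> K \<Longrightarrow> dir t \<bullet> y \<le> supp K t"
  unfolding supp_def by (intro cSUP_upper supp_bdd)

lemma supp_attained:
  assumes "compact K" "K \<noteq> {}"
  obtains y where "y \<in> K" "dir t \<bullet> y = supp K t"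
proof -
  have "continuous_on K (\<lambda>y. dir t \<bullet> y)" by (intro continuous_intros)
  then obtain y where y: "y \<in> K" "\<And>z. z \<in> K \<Longrightarrow> dir t \<bullet> z \<le> dir t \<bullet> y"
    using continuous_attains_sup[OF assms] by blast
  then have "supp K t = dir t \<bullet> y"
    unfolding supp_def using assms by (intro cSup_eq_maximum) auto
  then show ?thesis using that y by simp
qed

lemma supp_ge_1: "compact K \<Longrightarrow> cball 0 1 \<subseteq> K \<Longrightarrow> 1 \<le> supp K t"
  using inner_le_supp[of K "dir t" t] by (auto simp: inner_dir_dir subset_iff)

text \<open>The discrete form of \<open>h + h'' \<ge> 0\<close>: test a support point for
  \<open>t\<close> in both neighbouring directions, whose sum is \<open>2 cos d\<close> times
  \<open>dir t\<close>.\<close>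

lemma supp_convex:
  assumes "compact K" "K \<noteq> {}"
  shows "2 * cos d * supp K t \<le> supp K (t - d) + supp K (t + d)"
proof -
  obtain y where y: "y \<in> K" "dir t \<bullet> y = supp K t" using supp_attained assms by blast
  have "2 * cos d * supp K t = dir (t - d) \<bullet> y + dir (t + d) \<bullet> y"
    unfolding y(2)[symmetric] by (simp add: inner_2 cos_add cos_diff sin_add sin_diff algebra_simps)
  then show ?thesis using inner_le_supp[OF assms(1) y(1)] by (simp add: add_mono)
qed

lemma inner_dir_Lipschitz: "\<bar>dir s \<bullet> y - dir t \<bullet> y\<bar> \<le> norm y * \<bar>s - t\<bar>"
proof -
  have "\<bar>(dir s - dir t) \<bullet> y\<bar> \<le> norm (dir s - dir t) * norm y" by (rule Cauchy_Schwarz_ineq2)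
  also have "\<dots> \<le> \<bar>s - t\<bar> * norm y"
    using dist_dir_le[of s t] by (intro mult_right_mono) (auto simp: dist_norm)
  finally show ?thesis by (simp add: inner_diff_left mult.commute)
qed

text \<open>Sample \<open>supp K\<close> at \<open>n\<close> equal steps, bound both areas by
  triangles, apply \<open>support_sequence_bound\<close>, and let \<open>n\<close> tend to
  infinity.\<close>

lemma sector_area:
  assumes K: "compact K" "cball 0 1 \<subseteq> K" and L: "compact L"
    and polar: "\<And>x y. x \<in> L \<Longrightarrow> y \<in> K \<Longrightarrow> x \<bullet> y \<le> 1"
    and ab: "a \<le> b" "b \<le> a + pi / 2" and contact: "supp K a = 1" "supp K b = 1"
  shows "measure lebesgue (K \<inter> sector a b) + measure lebesgue (L \<inter> sector a b) \<le> b - a"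
proof (cases "a = b")
  case True
  have "sector a a = {x. vector [- sin a, cos a] \<bullet> x = 0}"
    by (auto simp: sector_def crs_def inner_2)
  moreover have "vector [- sin a, cos a] \<noteq> (0 :: real ^ 2)"
    using sin_zero_abs_cos_one[of a] by (auto simp: vec2_eq_iff)
  ultimately have "negligible (sector a a)" by (simp add: negligible_hyperplane)
  then have "negligible (K \<inter> sector a b)" "negligible (L \<inter> sector a b)"
    unfolding True by (auto intro: negligible_subset)
  then show ?thesis by (simp add: negligible_imp_measure0 True)
next
  case False
  define l where "l = b - a"
  have l: "0 < l" "l \<le> pi / 2" using ab False by (auto simp: l_def)
  obtain M where M: "1 \<le> M" "\<And>y. y \<in> K \<Longrightarrow> norm y \<le> M"
  proof -
    obtain B where "\<forall>y\<in>K. norm y \<le> B"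
      using compact_imp_bounded[OF K(1)] unfolding bounded_iff by blast
    then show thesis using that[of "max 1 B"] by fastforce
  qed
  have K0: "K \<noteq> {}" using K(2) by auto
  have supp_le: "supp K t \<le> M" for t
  proof -
    obtain y where "y \<in> K" "dir t \<bullet> y = supp K t" using supp_attained K K0 by blast
    then show ?thesis using M(2)[of y] norm_cauchy_schwarz[of "dir t" y] by simp
  qed
  have meas: "K \<inter> sector a b \<in> lmeasurable" "L \<inter> sector a b \<in> lmeasurable"
    using K L by (auto intro!: lmeasurable_compact compact_Int_closed closed_sector)
  \<comment> \<open>The bound per sampling step for twice the sum of the areas;
    \<open>E d = 2 d + O(d^2)\<close>.\<close>
  define E where "E d = (2 * (1 - cos d) / sin d - sin d * cos d) * M\<^sup>2 + sin d * (1 - cos d)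
        + 2 * sin d * cos d + 8 * M * d * sin d" for d
  let ?V = "measure lebesgue (K \<inter> sector a b) + measure lebesgue (L \<inter> sector a b)"
  have bound: "?V \<le> l / 2 * (E (l / real n) / (l / real n))" if n: "0 < n" "M * (l / real n) \<le> 1 / 2" for n
  proof -
    define d where "d = l / real n"
    have d: "0 < d" "real n * d = l" using n l by (auto simp: d_def)
    define h where "h j = supp K (a + real j * d)" for j
    have bn: "b = a + real n * d" using d by (simp add: l_def)
    have h0: "h 0 = 1" "h n = 1" using contact by (simp_all add: h_def bn)
    have h: "1 \<le> h j" "h j \<le> M" for j
      using supp_ge_1 K supp_le by (auto simp: h_def)
    have V1: "measure lebesgue (K \<inter> sector a b)
      \<le> (\<Sum>j<n. (2 * h j * h (Suc j) - cos d * ((h j)\<^sup>2 + (h (Suc j))\<^sup>2)) / sin d) / 2"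
    proof (rule sector_measure_circumscribed)
      show "2 * cos d * h (Suc j) \<le> h j + h (Suc (Suc j))" for j
        using supp_convex[OF K(1) K0, of d "a + real (Suc j) * d"] by (simp add: h_def algebra_simps)
      show "dir (a + real j * d) \<bullet> x \<le> h j" if "x \<in> K \<inter> sector a b" for x j
        unfolding h_def using that by (intro inner_le_supp K) simp
      show "real n * d \<le> pi / 2" using d l by simp
      show "K \<inter> sector a b \<subseteq> sector a (a + real n * d)" using bn by simp
      show "1 \<le> h j" for j by (rule h)
    qed (fact n d h0 meas)+
    have "\<exists>y. y \<in> K \<and> dir t \<bullet> y = supp K t" for t
      using supp_attained K K0 by metis
    then obtain y where y: "\<And>t. y t \<in> K" "\<And>t. dir t \<bullet> y t = supp K t" by metis
    have V2: "measure lebesgue (L \<inter> sector a b) \<le> (\<Sum>j<n. sin d / (h j - M * d)\<^sup>2) / 2"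
    proof (rule sector_measure_inscribed[where y = "\<lambda>j. y (a + real j * d)"])
      fix j
      let ?t = "a + real j * d"
      have "M * d \<le> 1 / 2" "0 \<le> M * d" using n d M by (simp_all add: d_def[symmetric])
      then show "0 < h j - M * d" "h j - M * d \<le> dir ?t \<bullet> y ?t"
        using h(1)[of j] y(2)[of ?t] by (auto simp: h_def)
      \<comment> \<open>One support point serves both ends of the step: turning the direction by
        \<open>d\<close> changes its inner product by at most \<open>M d\<close>.\<close>
      have "\<bar>dir (a + real (Suc j) * d) \<bullet> y ?t - h j\<bar> \<le> norm (y ?t) * d"
        using inner_dir_Lipschitz[of "a + real (Suc j) * d" "y ?t" ?t] d y(2)[of ?t]
        by (simp add: h_def algebra_simps)
      also have "\<dots> \<le> M * d" using M(2)[OF y(1)] d by (intro mult_right_mono) auto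
      finally show "h j - M * d \<le> dir (a + real (Suc j) * d) \<bullet> y ?t" by linarith
      show "x \<bullet> y ?t \<le> 1" if "x \<in> L \<inter> sector a b" for x
        using that by (intro polar y) simp
    next
      show "real n * d \<le> pi / 2" using d l by simp
      show "L \<inter> sector a b \<subseteq> sector a (a + real n * d)" using bn by simp
    qed (fact n d meas)+
    have "(\<Sum>j<n. (2 * h j * h (Suc j) - cos d * ((h j)\<^sup>2 + (h (Suc j))\<^sup>2)) / sin d
            + sin d / (h j - M * d)\<^sup>2) \<le> real n * E d"
      unfolding E_def using n d l h h0 by (intro support_sequence_bound) (auto simp: d_def)
    then have "?V \<le> real n * E d / 2"
      using V1 V2 by (simp add: sum.distrib)
    also have "\<dots> = l / 2 * (E d / d)" using d by (simp add: field_simps)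
    finally show ?thesis by (simp add: d_def)
  qed
  have "filterlim (\<lambda>n. l / real n) (at_right 0) sequentially"
    using l by real_asymp
  moreover have "((\<lambda>d. E d / d) \<longlongrightarrow> 2) (at_right 0)"
    unfolding E_def by real_asymp
  ultimately have "(\<lambda>n. E (l / real n) / (l / real n)) \<longlonglongrightarrow> 2"
    by (rule filterlim_compose[rotated])
  then have lim: "(\<lambda>n. l / 2 * (E (l / real n) / (l / real n))) \<longlonglongrightarrow> l / 2 * 2"
    by (intro tendsto_intros)
  have "(\<lambda>n. M * (l / real n)) \<longlonglongrightarrow> 0" by real_asymp
  then have "\<forall>\<^sub>F n in sequentially. M * (l / real n) < 1 / 2"
    by (rule order_tendstoD) simp
  then have "\<forall>\<^sub>F n in sequentially. ?V \<le> l / 2 * (E (l / real n) / (l / real n))"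
    using eventually_gt_at_top[of 0] by eventually_elim (use bound in auto)
  from tendsto_lowerbound[OF lim this] show ?thesis by (simp add: l_def)
qed

section \<open>Contact directions\<close>

lemma origin_symmetric_minus: "origin_symmetric K \<Longrightarrow> x \<in> K \<Longrightarrow> - x \<in> K"
  unfolding origin_symmetric_def by (metis imageI)

lemma origin_symmetricI: "(\<And>x. x \<in> K \<Longrightarrow> - x \<in> K) \<Longrightarrow> origin_symmetric K"
  unfolding origin_symmetric_def by (force simp: image_iff)

lemma supp_add_pi:
  assumes "compact K" "K \<noteq> {}" "origin_symmetric K"
  shows "supp K (t + pi) = supp K t"
proof -
  have "supp K s \<le> supp K (s + pi)" "supp K (s + pi) \<le> supp K s" for s
    using supp_attained[OF assms(1,2), of s] supp_attained[OF assms(1,2), of "s + pi"]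
      inner_le_supp[OF assms(1)] origin_symmetric_minus[OF assms(3)]
    by (metis dir_add_pi inner_minus_left inner_minus_right minus_minus)+
  then show ?thesis by (rule antisym[rotated])
qed

lemma continuous_supp:
  assumes "compact K" "K \<noteq> {}"
  shows "continuous_on UNIV (supp K)"
proof -
  obtain M where M: "\<And>y. y \<in> K \<Longrightarrow> norm y \<le> M"
    using compact_imp_bounded[OF assms(1)] unfolding bounded_iff by blast
  have M0: "0 \<le> M" using assms(2) M norm_ge_zero order_trans by blast
  have le: "supp K s \<le> supp K t + M * dist s t" for s t
  proof -
    obtain y where y: "y \<in> K" "dir s \<bullet> y = supp K s" using supp_attained assms by blast
    have "norm y * \<bar>s - t\<bar> \<le> M * \<bar>s - t\<bar>" using M y by (intro mult_right_mono) auto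
    then show ?thesis
      using inner_dir_Lipschitz[of s y t] inner_le_supp[OF assms(1) y(1), of t] y(2)
      by (simp add: dist_real_def)
  qed
  have "M-lipschitz_on UNIV (supp K)"
    using le M0 by (intro lipschitz_onI) (smt (verit) dist_real_def dist_commute)+
  then show ?thesis by (rule lipschitz_on_continuous_on)
qed

text \<open>The support function of the ellipse with semiaxes \<open>sqrt A\<close> in direction \<open>m\<close> and \<open>sqrt B\<close>
  orthogonally to it is \<open>sqrt (A * (cos (t - m))\<^sup>2 + B * (sin (t - m))\<^sup>2)\<close>.\<close>

definition unstretchable :: "(real ^ 2) set \<Rightarrow> bool" where
  "unstretchable K \<longleftrightarrow> (\<forall>m A B. 0 < A \<longrightarrow> 0 < B \<longrightarrow>
      (\<forall>t. \<bar>t - m\<bar> \<le> pi / 2 \<longrightarrow> A * (cos (t - m))\<^sup>2 + B * (sin (t - m))\<^sup>2 \<le> (supp K t)\<^sup>2)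
      \<longrightarrow> A * B \<le> 1)"

text \<open>If an arc of length \<open>\<pi>/2\<close> contained no contact direction, the disc could be stretched along
  the middle of the arc into an ellipse of larger area that still has a support function below
  \<open>supp K\<close>.\<close>

lemma contact_in_quarter_arc:
  assumes K: "compact K" "cball 0 1 \<subseteq> K"
    and rigid: "unstretchable K"
  obtains t where "c \<le> t" "t \<le> c + pi / 2" "supp K t = 1"
proof (rule ccontr)
  assume no: "\<not> thesis"
  have K0: "K \<noteq> {}" using K by auto
  have cont: "continuous_on UNIV (supp K)" by (rule continuous_supp[OF K(1) K0])
  have ge1: "1 \<le> supp K t" for t by (rule supp_ge_1[OF K])
  have "{c..c + pi / 2} \<subseteq> {t. 1 < supp K t}"
    using no that ge1 by (force simp: order_less_le)
  moreover have "open {t. 1 < supp K t}"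
    using cont by (intro open_Collect_less) auto
  \<comment> \<open>Compactness gives a margin: \<open>supp K\<close> still exceeds 1 on a slightly
    longer arc.\<close>
  ultimately obtain e where e: "e > 0" "(\<Union>t\<in>{c..c + pi / 2}. cball t e) \<subseteq> {t. 1 < supp K t}"
    using compact_subset_open_imp_cball_epsilon_subset[of "{c..c + pi / 2}"] by (metis compact_Icc)
  define d where "d = min e (pi / 4)"
  have d: "0 < d" "d \<le> pi / 4" "d \<le> e" using e by (auto simp: d_def)
  define m where "m = c + pi / 4"
  have gt1: "1 < supp K t" if "\<bar>t - m\<bar> \<le> pi / 4 + d" for t
  proof -
    define t' where "t' = max c (min t (c + pi / 2))"
    have "t' \<in> {c..c + pi / 2}" "t \<in> cball t' e"
      using that d by (auto simp: t'_def m_def dist_real_def abs_le_iff max_def min_def field_simps)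
    then show ?thesis using e(2) by blast
  qed
  have "\<exists>v. 1 < v \<and> (\<forall>t. \<bar>t - m\<bar> \<le> pi / 4 + d \<longrightarrow> v \<le> supp K t)"
  proof -
    have "compact (cball m (pi / 4 + d))" "cball m (pi / 4 + d) \<noteq> {}"
      using d by auto
    moreover have "continuous_on (cball m (pi / 4 + d)) (supp K)"
      using cont continuous_on_subset by blast
    ultimately obtain z where "z \<in> cball m (pi / 4 + d)" "\<forall>t\<in>cball m (pi / 4 + d). supp K z \<le> supp K t"
      using continuous_attains_inf by blast
    then show ?thesis
      using gt1[of z] by (intro exI[of _ "supp K z"]) (auto simp: dist_real_def abs_minus_commute)
  qed
  then obtain v where v: "1 < v" "\<And>t. \<bar>t - m\<bar> \<le> pi / 4 + d \<Longrightarrow> v \<le> supp K t" by blast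
  define s where "s = sin (2 * d)"
  have s: "0 < s" "s \<le> 1" unfolding s_def using d by (auto intro!: sin_gt_zero)
  \<comment> \<open>The first bound on \<open>u\<close> controls the enlarged arc, where
    \<open>supp K \<ge> v\<close>; the second controls its complement, where
    \<open>cos (2 (t - m)) \<le> - s\<close>.\<close>
  define u where "u = min (v\<^sup>2 - 1) (s / 2)"
  have "1 < v\<^sup>2" using v(1) by (simp add: one_less_power)
  have u: "0 < u" "1 + u \<le> v\<^sup>2" "2 * u \<le> s"
  proof -
    have "u \<le> v\<^sup>2 - 1" "u \<le> s / 2" unfolding u_def by (rule min.cobounded1 min.cobounded2)+
    moreover have "0 < u" using \<open>1 < v\<^sup>2\<close> s by (simp add: u_def)
    ultimately show "0 < u" "1 + u \<le> v\<^sup>2" "2 * u \<le> s" by linarith+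
  qed
  \<comment> \<open>The quadratic term in \<open>B\<close> lifts \<open>A * B\<close> above 1, while
    off the arc the gain \<open>2 u^2\<close> is absorbed by the loss \<open>u s\<close>.\<close>
  define A B where "A = 1 + u" and "B = 1 - u + 2 * u\<^sup>2"
  have uu: "2 * u\<^sup>2 \<le> u" using mult_left_mono[of "2 * u" 1 u] u s by (simp add: power2_eq_square)
  have AB: "0 < A" "0 < B" "B \<le> 1" unfolding A_def B_def using u s uu zero_le_power2[of u] by linarith+
  have "A * B \<le> 1"
  proof (rule rigid[unfolded unstretchable_def, rule_format, OF AB(1,2)])
    fix t :: real
    assume t: "\<bar>t - m\<bar> \<le> pi / 2"
    let ?C = "(cos (t - m))\<^sup>2" and ?S = "(sin (t - m))\<^sup>2"
    have CS: "?C + ?S = 1" by simp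
    show "A * ?C + B * ?S \<le> (supp K t)\<^sup>2"
    proof (cases "\<bar>t - m\<bar> \<le> pi / 4 + d")
      case True
      have "B * ?S \<le> A * ?S" using AB u by (intro mult_right_mono) (auto simp: A_def)
      then have "A * ?C + B * ?S \<le> A * (?C + ?S)" unfolding distrib_left by linarith
      also have "\<dots> \<le> v\<^sup>2" using u CS by (simp add: A_def)
      also have "\<dots> \<le> (supp K t)\<^sup>2" using v True by (intro power_mono) auto
      finally show ?thesis .
    next
      case False
      have "cos (2 * \<bar>t - m\<bar>) \<le> cos (pi / 2 + 2 * d)"
        using False t d by (intro cos_monotone_0_pi_le) auto
      then have "cos (2 * (t - m)) \<le> - s"
        using cos_abs_real[of "2 * (t - m)"] unfolding abs_mult by (simp add: s_def cos_add)
      then have "?C - ?S \<le> - s" by (simp only: cos_double)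
      then have "u * (?C - ?S) \<le> - (u * s)" using mult_left_mono[of "?C - ?S" "- s" u] u by simp
      moreover have "A * ?C + B * ?S = (?C + ?S) + u * (?C - ?S) + 2 * u\<^sup>2 * ?S"
        by (simp add: A_def B_def algebra_simps)
      moreover have "2 * u\<^sup>2 * ?S \<le> 2 * u\<^sup>2 * 1"
        using CS zero_le_power2[of "cos (t - m)"] by (intro mult_left_mono) (linarith, simp)
      moreover have "2 * u\<^sup>2 \<le> u * s" using mult_left_mono[of "2 * u" s u] u by (simp add: power2_eq_square mult_ac)
      ultimately have "A * ?C + B * ?S \<le> 1" using CS by linarith
      also have "1 \<le> (supp K t)\<^sup>2" using ge1 by (intro one_le_power)
      finally show ?thesis .
    qed
  qed
  moreover have "A * B = 1 + u\<^sup>2 + 2 * u ^ 3"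
    by (simp add: A_def B_def power2_eq_square power3_eq_cube algebra_simps)
  moreover have "0 < u\<^sup>2 + 2 * u ^ 3" using u by (intro add_pos_pos) auto
  ultimately show False by linarith
qed

text \<open>Contact directions divide the full turn into six arcs to which
  \<open>sector_area\<close> applies. The condition linking \<open>K\<close> and \<open>L\<close> is
  symmetric, so a body and its polar may take either role.\<close>

lemma area_sum_le:
  assumes K: "compact K" "cball 0 1 \<subseteq> K" "origin_symmetric K" and L: "compact L"
    and polar: "\<And>x y. x \<in> L \<Longrightarrow> y \<in> K \<Longrightarrow> x \<bullet> y \<le> 1"
    and rigid: "unstretchable K"
  shows "measure lebesgue K + measure lebesgue L \<le> 2 * pi"
proof -
  have K0: "K \<noteq> {}" using K by auto
  define C where "C = {t. supp K t = 1}"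
  have gap: "\<exists>t\<in>C. c \<le> t \<and> t \<le> c + pi / 2" for c
    using contact_in_quarter_arc[of K c, OF K(1,2) rigid] unfolding C_def by blast
  have C_pi: "t + pi \<in> C" if "t \<in> C" for t
    using that supp_add_pi[OF K(1) K0 K(3)] by (simp add: C_def)
  have "closed C"
    unfolding C_def using continuous_supp[OF K(1) K0] by (intro closed_Collect_eq) auto
  then have cpt: "compact (C \<inter> {x..y})" for x y by (intro closed_Int_compact) auto
  obtain t0 where t0: "t0 \<in> C" using gap by blast
  \<comment> \<open>Take the last contact \<open>t1\<close> before, and the first contact
    \<open>t2\<close> after, the angle \<open>t0 + pi / 2\<close>, equality allowed; then no contact
    lies strictly between them.\<close>
  have "C \<inter> {t0..t0 + pi / 2} \<noteq> {}" using t0 by auto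
  then obtain t1 where "t1 \<in> C \<inter> {t0..t0 + pi / 2}" "\<forall>t\<in>C \<inter> {t0..t0 + pi / 2}. t \<le> t1"
    using compact_attains_sup[OF cpt] by blast
  then have t1: "t1 \<in> C" "t0 \<le> t1" "t1 \<le> t0 + pi / 2"
    and t1_max: "\<And>t. t \<in> C \<Longrightarrow> t0 \<le> t \<Longrightarrow> t \<le> t0 + pi / 2 \<Longrightarrow> t \<le> t1"
    by auto
  have "C \<inter> {t0 + pi / 2..t0 + pi} \<noteq> {}" using C_pi[OF t0] by auto
  then obtain t2 where "t2 \<in> C \<inter> {t0 + pi / 2..t0 + pi}" "\<forall>t\<in>C \<inter> {t0 + pi / 2..t0 + pi}. t2 \<le> t"
    using compact_attains_inf[OF cpt] by blast
  then have t2: "t2 \<in> C" "t0 + pi / 2 \<le> t2" "t2 \<le> t0 + pi"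
    and t2_min: "\<And>t. t \<in> C \<Longrightarrow> t0 + pi / 2 \<le> t \<Longrightarrow> t \<le> t0 + pi \<Longrightarrow> t2 \<le> t"
    by auto
  have t12: "t2 \<le> t1 + pi / 2"
  proof (rule ccontr)
    assume "\<not> t2 \<le> t1 + pi / 2"
    \<comment> \<open>The quarter arc centred midway between \<open>t1\<close> and \<open>t2\<close>
      would lie strictly between them.\<close>
    then obtain t where "t \<in> C" "t1 < t" "t < t2"
      using gap[of "(t1 + t2) / 2 - pi / 4"] by (auto simp: field_simps)
    then show False using t1_max[of t] t2_min[of t] t1 t2 by linarith
  qed
  \<comment> \<open>Three arcs cover a half turn, and the shift by \<open>pi\<close> repeats them;
    some may be degenerate.\<close>
  define e where "e i = [t0, t1, t2, t0 + pi, t1 + pi, t2 + pi, t0 + 2 * pi] ! i" for i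
  have e: "e i \<le> e (Suc i)" "e (Suc i) \<le> e i + pi / 2" "e i \<in> C" "e (Suc i) \<in> C" if "i < 6" for i
  proof -
    have "t0 + 2 * pi \<in> C" using C_pi[OF C_pi[OF t0]] by (simp add: algebra_simps)
    moreover have "i = 0 \<or> i = 1 \<or> i = 2 \<or> i = 3 \<or> i = 4 \<or> i = 5" using that by auto
    ultimately show "e i \<le> e (Suc i)" "e (Suc i) \<le> e i + pi / 2" "e i \<in> C" "e (Suc i) \<in> C"
      using t0 t1 t2 t12 C_pi[OF t0] C_pi[OF t1(1)] C_pi[OF t2(1)] pi_ge_zero
      by (elim disjE; simp add: e_def)+
  qed
  have e_ends: "e 0 = t0" "e 6 = t0 + 2 * pi" by (simp_all add: e_def)
  have cover: "\<exists>i<6. x \<in> sector (e i) (e (Suc i))" for x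
  proof -
    obtain r t where rt: "0 \<le> r" "t0 \<le> t" "t \<le> t0 + 2 * pi" "x = r *\<^sub>R dir t"
      using polar_form by blast
    have locate: "\<exists>i<n. e i \<le> t \<and> t \<le> e (Suc i)" if "t \<le> e n" "0 < n" for n
      using that
    proof (induction n)
      case (Suc n)
      then show ?case
        using rt e_ends by (cases "n = 0"; cases "t \<le> e n") (auto intro: less_SucI)
    qed simp
    obtain i where i: "i < 6" "e i \<le> t" "t \<le> e (Suc i)"
      using locate[of 6] rt e_ends by auto
    then have "0 \<le> sin (t - e i)" "sin (t - e (Suc i)) \<le> 0"
      using e(2)[of i] sin_ge_zero[of "t - e i"] sin_ge_zero[of "e (Suc i) - t"]
        sin_minus[of "e (Suc i) - t"] by auto
    then have "x \<in> sector (e i) (e (Suc i))"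
      using rt by (simp add: sector_def crs_dir_dir mult_nonneg_nonpos)
    then show ?thesis using i by blast
  qed
  have split: "measure lebesgue X \<le> (\<Sum>i<6. measure lebesgue (X \<inter> sector (e i) (e (Suc i))))"
    if "compact X" for X
  proof -
    have X: "X \<inter> sector a b \<in> lmeasurable" for a b
      using that by (intro lmeasurable_compact compact_Int_closed closed_sector)
    have "X = (\<Union>i<6. X \<inter> sector (e i) (e (Suc i)))" using cover by auto
    then have "measure lebesgue X = measure lebesgue (\<Union>i<6. X \<inter> sector (e i) (e (Suc i)))" by simp
    also have "\<dots> \<le> (\<Sum>i<6. measure lebesgue (X \<inter> sector (e i) (e (Suc i))))"
      using X by (intro measure_UNION_le) (auto simp: fmeasurableD)
    finally show ?thesis .
  qed
  have "measure lebesgue K + measure lebesgue L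
    \<le> (\<Sum>i<6. measure lebesgue (K \<inter> sector (e i) (e (Suc i))) + measure lebesgue (L \<inter> sector (e i) (e (Suc i))))"
    unfolding sum.distrib using split K(1) L by (intro add_mono)
  also have "\<dots> \<le> (\<Sum>i<6. e (Suc i) - e i)"
    using e by (intro sum_mono sector_area K L polar) (auto simp: C_def)
  also have "\<dots> = 2 * pi"
    unfolding sum_lessThan_telescope e_ends by simp
  finally show ?thesis .
qed

section \<open>Ellipses and polarity\<close>

text \<open>The self-adjoint map with eigenvalues \<open>a\<close> along \<open>dir m\<close> and
  \<open>b\<close> orthogonally to it.\<close>

definition stretch :: "real \<Rightarrow> real \<Rightarrow> real \<Rightarrow> real ^ 2 \<Rightarrow> real ^ 2" where
  "stretch m a b x = (a * (dir m \<bullet> x)) *\<^sub>R dir m + (b * crs (dir m) x) *\<^sub>R dir (m + pi / 2)"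

lemma linear_stretch: "linear (stretch m a b)"
  by (intro linearI) (simp_all add: stretch_def crs_def inner_2 vec2_eq_iff algebra_simps)

lemma coordinates_stretch:
  "dir m \<bullet> stretch m a b x = a * (dir m \<bullet> x)" "crs (dir m) (stretch m a b x) = b * crs (dir m) x"
proof -
  have "dir m \<bullet> dir (m + pi / 2) = 0" "crs (dir m) (dir (m + pi / 2)) = 1"
    "dir m \<bullet> dir m = 1" "crs (dir m) (dir m) = 0"
    by (simp_all add: inner_dir_dir crs_dir_dir)
  moreover have "crs x (y + z) = crs x y + crs x z" for x y z
    by (simp add: crs_def algebra_simps)
  ultimately show "dir m \<bullet> stretch m a b x = a * (dir m \<bullet> x)"
    "crs (dir m) (stretch m a b x) = b * crs (dir m) x"
    by (simp_all add: stretch_def inner_add_right)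
qed

lemma stretch_stretch: "stretch m a b (stretch m c d x) = stretch m (a * c) (b * d) x"
  by (simp add: stretch_def[of m a b] coordinates_stretch) (simp add: stretch_def mult_ac)

lemma stretch_1_1: "stretch m 1 1 x = x"
  by (simp add: stretch_def orthonormal_expansion)

lemma stretch_inverse:
  assumes "a \<noteq> 0" "b \<noteq> 0"
  shows "stretch m a b (stretch m (1 / a) (1 / b) x) = x" "stretch m (1 / a) (1 / b) (stretch m a b x) = x"
  using assms by (simp_all add: stretch_stretch stretch_1_1)

lemma inner_stretch: "stretch m a b x \<bullet> y = x \<bullet> stretch m a b y"
  by (simp add: stretch_def inner_2 crs_def cos_add sin_add algebra_simps)

text \<open>By self-adjointness this is the squared support function of the stretched disc, which
  gives the formula in \<open>unstretchable\<close> for \<open>a = sqrt A\<close>,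
  \<open>b = sqrt B\<close>.\<close>

lemma norm_stretch_dir: "(norm (stretch m a b (dir t)))\<^sup>2 = a\<^sup>2 * (cos (t - m))\<^sup>2 + b\<^sup>2 * (sin (t - m))\<^sup>2"
proof -
  have "(norm (stretch m a b (dir t)))\<^sup>2 = dir t \<bullet> stretch m a b (stretch m a b (dir t))"
    by (simp add: power2_norm_eq_inner inner_stretch)
  also have "\<dots> = a\<^sup>2 * (dir t \<bullet> dir m)\<^sup>2 + b\<^sup>2 * (crs (dir m) (dir t) * (dir t \<bullet> dir (m + pi / 2)))"
    by (simp only: stretch_stretch) (simp add: stretch_def inner_add_right inner_commute power2_eq_square algebra_simps)
  also have "dir t \<bullet> dir (m + pi / 2) = sin (t - m)"
    by (simp add: inner_2 cos_add sin_add sin_diff)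
  finally show ?thesis by (simp add: inner_dir_dir crs_dir_dir power2_eq_square)
qed

lemma det_stretch: "det (matrix (stretch m a b)) = a * b"
proof -
  have "(sin m)\<^sup>2 + (cos m)\<^sup>2 = 1" by simp
  then have "(a * cos m * cos m + b * sin m * sin m) * (a * sin m * sin m + b * cos m * cos m)
    - (a * sin m * cos m - b * cos m * sin m) * (a * cos m * sin m - b * sin m * cos m) = a * b"
    by algebra
  then show ?thesis
    unfolding det_2 matrix_def
    by (simp add: stretch_def inner_2 crs_def axis_def cos_add sin_add algebra_simps)
qed

lemma stretched_disc:
  assumes "0 < a" "0 < b"
  shows "ellipse (stretch m a b ` cball 0 1)" "origin_symmetric (stretch m a b ` cball 0 1)"
    "measure lebesgue (stretch m a b ` cball 0 1) = a * b * measure lebesgue (cball (0 :: real ^ 2) 1)"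
proof -
  have "bij (stretch m a b)"
    using assms stretch_inverse[of a b m]
    by (intro o_bij[of "stretch m (1 / a) (1 / b)"]) (auto simp: fun_eq_iff)
  then show "ellipse (stretch m a b ` cball 0 1)"
    unfolding ellipse_def using linear_stretch by (intro exI[of _ "stretch m a b"] exI[of _ 0]) auto
  show "origin_symmetric (stretch m a b ` cball 0 1)"
  proof (rule origin_symmetricI)
    fix x assume "x \<in> stretch m a b ` cball 0 1"
    then obtain z where "z \<in> cball 0 1" "x = stretch m a b z" by blast
    then show "- x \<in> stretch m a b ` cball 0 1"
      using linear_neg[OF linear_stretch] by (intro image_eqI[of _ _ "- z"]) auto
  qed
  show "measure lebesgue (stretch m a b ` cball 0 1) = a * b * measure lebesgue (cball (0 :: real ^ 2) 1)"
    using assms by (simp add: measure_linear_image[OF linear_stretch] det_stretch)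
qed

lemma measure_disc_pos: "0 < measure lebesgue (cball (0 :: real ^ 2) 1)"
  using content_cball_pos[of 1 "0 :: real ^ 2"] by simp

text \<open>Comparing support functions puts the ellipse inside \<open>K\<close>, by separation;
  maximality of the disc then bounds the product of the semiaxes.\<close>

lemma John_unstretchable:
  assumes K: "convex_body K" "origin_symmetric K" and J: "is_John_ellipse (cball 0 1) K"
  shows "unstretchable K"
  unfolding unstretchable_def
proof (intro allI impI)
  fix m A B :: real
  assume AB: "0 < A" "0 < B"
    and le: "\<forall>t. \<bar>t - m\<bar> \<le> pi / 2 \<longrightarrow> A * (cos (t - m))\<^sup>2 + B * (sin (t - m))\<^sup>2 \<le> (supp K t)\<^sup>2"
  have cK: "compact K" "convex K" using K by (auto simp: convex_body_def)
  have BK: "cball 0 1 \<subseteq> K" using J by (simp add: is_John_ellipse_def)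
  then have K0: "K \<noteq> {}" by auto
  define f where "f = stretch m (sqrt A) (sqrt B)"
  have "f ` cball 0 1 \<subseteq> K"
  proof
    fix x assume "x \<in> f ` cball 0 1"
    then obtain z where z: "norm z \<le> 1" "x = f z" by auto
    show "x \<in> K"
    proof (rule ccontr)
      assume "x \<notin> K"
      then obtain w c where w: "w \<bullet> x < c" "\<And>y. y \<in> K \<Longrightarrow> c < w \<bullet> y"
        using separating_hyperplane_closed_point[OF cK(2) compact_imp_closed[OF cK(1)]] by blast
      obtain r t where rt: "\<bar>t - m\<bar> \<le> pi / 2" "w = r *\<^sub>R dir t" by (rule line_form)
      obtain y where y: "y \<in> K" "dir t \<bullet> y = supp K t" using supp_attained cK K0 by blast
      have supp0: "0 \<le> supp K t" using supp_ge_1[OF cK(1) BK, of t] by simp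
      have "(norm (f (dir t)))\<^sup>2 \<le> (supp K t)\<^sup>2"
        using le rt AB by (simp add: f_def norm_stretch_dir)
      then have n: "norm (f (dir t)) \<le> supp K t" using supp0 by (rule power2_le_imp_le)
      have "\<bar>w \<bullet> x\<bar> = \<bar>r\<bar> * \<bar>f (dir t) \<bullet> z\<bar>"
        using z by (simp add: rt f_def inner_stretch abs_mult)
      also have "\<dots> \<le> \<bar>r\<bar> * (norm (f (dir t)) * norm z)"
        by (intro mult_left_mono Cauchy_Schwarz_ineq2) auto
      also have "\<dots> \<le> \<bar>r\<bar> * (supp K t * 1)"
        using n z supp0 by (intro mult_left_mono mult_mono) auto
      finally have "\<bar>w \<bullet> x\<bar> \<le> \<bar>w \<bullet> y\<bar>" using supp0 y by (simp add: rt abs_mult)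
      \<comment> \<open>Both \<open>y\<close> and \<open>- y\<close> lie in \<open>K\<close>, so
        \<open>c < - \<bar>w \<bullet> y\<bar> \<le> - \<bar>w \<bullet> x\<bar> \<le> w \<bullet> x
        < c\<close>.\<close>
      then show False
        using w(1) w(2)[OF y(1)] w(2)[OF origin_symmetric_minus[OF K(2) y(1)]] by auto
    qed
  qed
  then have "measure lebesgue (f ` cball 0 1) \<le> measure lebesgue (cball (0 :: real ^ 2) 1)"
    using J stretched_disc(1,2)[of "sqrt A" "sqrt B" m] AB by (auto simp: is_John_ellipse_def f_def)
  then have "sqrt A * sqrt B \<le> 1"
    using stretched_disc(3)[of "sqrt A" "sqrt B" m] AB measure_disc_pos by (simp add: f_def)
  then show "A * B \<le> 1" by (simp flip: real_sqrt_mult)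
qed

text \<open>The dual argument: a point \<open>r *\<^sub>R dir t\<close> of \<open>K\<close>
  satisfies \<open>\<bar>r\<bar> * supp (polar_body K) t \<le> 1\<close>, so \<open>K\<close> lies
  in the ellipse with semiaxes \<open>1 / sqrt A\<close> and \<open>1 / sqrt B\<close>, to which
  minimality of the disc applies.\<close>

lemma Loewner_unstretchable_polar:
  assumes cP: "compact (polar_body K)" and BP: "cball 0 1 \<subseteq> polar_body K"
    and K: "origin_symmetric K" and J: "is_Loewner_ellipse (cball 0 1) K"
  shows "unstretchable (polar_body K)"
  unfolding unstretchable_def
proof (intro allI impI)
  fix m A B :: real
  let ?P = "polar_body K"
  assume AB: "0 < A" "0 < B"
    and le: "\<forall>t. \<bar>t - m\<bar> \<le> pi / 2 \<longrightarrow> A * (cos (t - m))\<^sup>2 + B * (sin (t - m))\<^sup>2 \<le> (supp ?P t)\<^sup>2"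
  define f where "f = stretch m (1 / sqrt A) (1 / sqrt B)"
  have P0: "?P \<noteq> {}" using BP by auto
  have "K \<subseteq> f ` cball 0 1"
  proof
    fix x assume x: "x \<in> K"
    let ?z = "stretch m (sqrt A) (sqrt B) x"
    obtain r t where rt: "\<bar>t - m\<bar> \<le> pi / 2" "x = r *\<^sub>R dir t" by (rule line_form)
    obtain y where y: "y \<in> ?P" "dir t \<bullet> y = supp ?P t" using supp_attained[OF cP P0] by blast
    have "y \<bullet> x \<le> 1" "y \<bullet> (- x) \<le> 1"
      using y(1) x origin_symmetric_minus[OF K x] unfolding polar_body_def by blast+
    moreover have "y \<bullet> x = r * supp ?P t" by (simp add: rt inner_commute flip: y(2))
    ultimately have "\<bar>r * supp ?P t\<bar> \<le> 1" by (simp add: abs_le_iff)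
    have "(norm ?z)\<^sup>2 = r\<^sup>2 * (norm (stretch m (sqrt A) (sqrt B) (dir t)))\<^sup>2"
      unfolding rt linear_scale[OF linear_stretch] by (simp add: power_mult_distrib)
    also have "\<dots> \<le> r\<^sup>2 * (supp ?P t)\<^sup>2"
      using le rt AB by (intro mult_left_mono) (simp_all add: norm_stretch_dir)
    also have "\<dots> \<le> 1" using \<open>\<bar>r * supp ?P t\<bar> \<le> 1\<close> by (simp add: abs_square_le_1 flip: power_mult_distrib)
    finally have "norm ?z \<le> 1" by (simp add: abs_square_le_1)
    moreover have "x = f ?z" using AB by (simp add: f_def stretch_inverse)
    ultimately show "x \<in> f ` cball 0 1" by auto
  qed
  then have "measure lebesgue (cball (0 :: real ^ 2) 1) \<le> measure lebesgue (f ` cball 0 1)"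
    using J stretched_disc(1,2)[of "1 / sqrt A" "1 / sqrt B" m] AB by (auto simp: is_Loewner_ellipse_def f_def)
  then have "1 * measure lebesgue (cball (0 :: real ^ 2) 1)
      \<le> (1 / sqrt A) * (1 / sqrt B) * measure lebesgue (cball (0 :: real ^ 2) 1)"
    using stretched_disc(3)[of "1 / sqrt A" "1 / sqrt B" m] AB by (simp add: f_def)
  then have "1 \<le> (1 / sqrt A) * (1 / sqrt B)"
    using measure_disc_pos by (simp only: mult_le_cancel_right_pos)
  then have "sqrt A * sqrt B \<le> 1" using AB by (simp add: field_simps)
  then show "A * B \<le> 1" by (simp flip: real_sqrt_mult)
qed

section \<open>Symmetric bodies, their polars, and the conclusion\<close>

lemma symmetric_body_contains_disc:
  fixes K :: "'a :: euclidean_space set"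
  assumes "convex_body K" "origin_symmetric K"
  obtains e where "0 < e" "cball 0 e \<subseteq> K"
proof -
  obtain x e where xe: "0 < e" "cball x e \<subseteq> K"
    using assms unfolding convex_body_def by (metis ex_in_conv mem_interior_cball)
  have "z \<in> K" if "z \<in> cball 0 e" for z
  proof -
    have "x + z \<in> K" "x - z \<in> K" using xe(2) that by (auto simp: subset_iff dist_norm)
    \<comment> \<open>The midpoint of \<open>x + z\<close> and \<open>- (x - z)\<close> is
      \<open>z\<close>, so a ball about \<open>x\<close> moves to the origin.\<close>
    then have "(1 / 2) *\<^sub>R (x + z) + (1 / 2) *\<^sub>R (- (x - z)) \<in> K"
      using assms by (intro convexD origin_symmetric_minus) (auto simp: convex_body_def)
    then show ?thesis by (simp add: algebra_simps flip: scaleR_add_left)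
  qed
  then show ?thesis using that xe(1) by blast
qed

text \<open>Closed as an intersection of half-spaces; testing with the point of norm
  \<open>e\<close> in the direction of \<open>x\<close> bounds \<open>norm x\<close> by
  \<open>1 / e\<close>.\<close>

lemma compact_polar_body:
  fixes K :: "'a :: euclidean_space set"
  assumes "0 < e" "cball 0 e \<subseteq> K"
  shows "compact (polar_body K)"
proof -
  have "polar_body K = (\<Inter>y\<in>K. {x. x \<bullet> y \<le> 1})" by (auto simp: polar_body_def)
  then have "closed (polar_body K)"
    by (auto intro!: closed_INT closed_Collect_le continuous_intros)
  moreover have "norm x \<le> 1 / e" if x: "x \<in> polar_body K" for x
  proof (cases "x = 0")
    case False
    have "(e / norm x) *\<^sub>R x \<in> K" using assms False by auto
    then have "x \<bullet> ((e / norm x) *\<^sub>R x) \<le> 1" using x unfolding polar_body_def by blast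
    moreover have "x \<bullet> ((e / norm x) *\<^sub>R x) = norm x * e"
      using False by (simp add: dot_square_norm power2_eq_square)
    ultimately show ?thesis using assms(1) by (simp add: pos_le_divide_eq)
  qed (use assms in simp)
  then have "bounded (polar_body K)" by (auto simp: bounded_iff)
  ultimately show ?thesis by (simp add: compact_eq_bounded_closed)
qed

lemma origin_symmetric_polar_body:
  assumes "origin_symmetric K"
  shows "origin_symmetric (polar_body K)"
proof (rule origin_symmetricI)
  fix x assume x: "x \<in> polar_body K"
  have "- x \<bullet> y \<le> 1" if "y \<in> K" for y
  proof -
    have "x \<bullet> (- y) \<le> 1"
      using x origin_symmetric_minus[OF assms that] unfolding polar_body_def by blast
    then show ?thesis by simp
  qed
  then show "- x \<in> polar_body K" by (simp add: polar_body_def)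
qed

theorem theoremB:
  fixes K :: "(real ^ 2) set"
  assumes "convex_body K"
    and "origin_symmetric K"
    and "is_John_ellipse (cball 0 1) K \<or> is_Loewner_ellipse (cball 0 1) K"
  shows "measure lebesgue K + measure lebesgue (polar_body K) \<le> 2 * pi"
proof -
  have K: "compact K" using assms by (simp add: convex_body_def)
  obtain e where e: "0 < e" "cball 0 e \<subseteq> K"
    using symmetric_body_contains_disc assms(1,2) by blast
  have P: "compact (polar_body K)" by (rule compact_polar_body[OF e])
  from assms(3) show ?thesis
  proof
    assume J: "is_John_ellipse (cball 0 1) K"
    then have "cball 0 1 \<subseteq> K" by (simp add: is_John_ellipse_def)
    then show ?thesis
      using K P assms John_unstretchable[OF assms(1,2) J]
      by (intro area_sum_le) (auto simp: polar_body_def)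
  next
    assume J: "is_Loewner_ellipse (cball 0 1) K"
    then have KB: "K \<subseteq> cball 0 1" by (simp add: is_Loewner_ellipse_def)
    have BP: "cball 0 1 \<subseteq> polar_body K"
    proof
      fix x :: "real ^ 2" assume x: "x \<in> cball 0 1"
      have "x \<bullet> y \<le> 1" if "y \<in> K" for y
        using norm_cauchy_schwarz[of x y] mult_mono[of "norm x" 1 "norm y" 1] KB that x by force
      then show "x \<in> polar_body K" by (simp add: polar_body_def)
    qed
    \<comment> \<open>Here the polar is the outer body containing the disc, and \<open>K\<close>
      takes the place of \<open>L\<close>.\<close>
    have "measure lebesgue (polar_body K) + measure lebesgue K \<le> 2 * pi"
      using P K BP origin_symmetric_polar_body[OF assms(2)] Loewner_unstretchable_polar[OF P BP assms(2) J]
      by (intro area_sum_le) (auto simp: polar_body_def inner_commute)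
    then show ?thesis by simp
  qed
qed

end
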